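(* Let $\Gamma$ be a Lie group acting linearly on a $2n$-dimensional symplectic vector space $(V,\omega)$ and let $\rho:\Gamma\to GL(2n)$ be the representation of $\Gamma$ on $V$. Then $\rho(\Gamma)$ is a subgroup of $\Omega_n=Sp_\omega(n;\mathbb{R})\,\dot\cup\,Sp_\omega^{-1}(n;\mathbb{R})$ if and only if the action of $\Gamma$ on $(V,\omega)$ is $\sigma$-semisymplectic for some group homomorphism $\sigma:\Gamma\to\mathbb{Z}_2$. In particular, $\rho(\Gamma)$ is a subgroup of $Sp_\omega(n;\mathbb{R})$ if and only if the action of $\Gamma$ on $(V,\omega)$ is symplectic.
   Context: A symplectic vector space $(V,\omega)$ is a finite-dimensional real vector space $V$ with an alternating non-degenerate bilinear form $\omega$. Fix a basis of $V$; $[\omega]$ is the matrix of $\omega$ in it and $GL(V)$ is identified with $GL(2n)$ (invertible real $2n\times 2n$ matrices), so that $\rho(\gamma)$ is the matrix of $\rho_\gamma:V\to V$, $\rho_\gamma(x)=\gamma x$. $Sp_\omega(n;\mathbb{R})=\{B\in\mathbb{M}_{2n}(\mathbb{R}):B^T[\omega]B=[\omega]\}$ and $Sp_\omega^{-1}(n;\mathbb{R})=\{B\in\mathbb{M}_{2n}(\mathbb{R}):B^T[\omega]B=-[\omega]\}$. For a group homomorphism $\sigma:\Gamma\to\mathbb{Z}_2=\{\pm1\}$, the action is $\sigma$-semisymplectic if $(\rho_\gamma)^*\omega=\sigma(\gamma)\omega$ for all $\gamma\in\Gamma$, i.e. $\omega(d(\rho_\gamma)_x u,d(\rho_\gamma)_x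 v)=\sigma(\gamma)\omega(u,v)$ for all $\gamma\in\Gamma$ and $x,u,v\in V$. It is symplectic if this holds with $\sigma$ trivial. *)

theory Defs
  imports "HOL-Analysis.Analysis" "HOL-Algebra.Group_Action" "HOL-Algebra.Sym_Groups"
begin

section \<open>Lie groups\<close>

text \<open>
  The two predicates below are meant for open \<open>S\<close> and a finite-dimensional domain, where
  continuity of all directional derivatives up to order \<open>k\<close> is the usual notion of class $C^k$.
\<close>

primrec Ck_on :: "nat \<Rightarrow> 'a::real_normed_vector set \<Rightarrow> ('a \<Rightarrow> 'b::real_normed_vector) \<Rightarrow> bool" where
  "Ck_on 0 S f \<longleftrightarrow> continuous_on S f"
| "Ck_on (Suc k) S f \<longleftrightarrow>
     (\<forall>x\<in>S. f differentiable (at x)) \<and> (\<forall>v. Ck_on k S (\<lambda>x. frechet_derivative f (at x) v))"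

definition smooth_on :: "'a::real_normed_vector set \<Rightarrow> ('a \<Rightarrow> 'b::real_normed_vector) \<Rightarrow> bool" where
  "smooth_on S f \<longleftrightarrow> (\<forall>k. Ck_on k S f)"

text \<open>
  A chart is a pair of a domain and a map that matters only on this domain. The model space \<open>'e\<close>
  is any finite-dimensional normed space; it is not required to be a \<open>euclidean_space\<close>, because
  that class excludes dimension 0, that is, the discrete (in particular the finite) Lie groups.
\<close>

type_synonym ('p, 'e) chart = "'p set \<times> ('p \<Rightarrow> 'e)"

definition smooth_manifold :: "'p topology \<Rightarrow> ('p, 'e::real_normed_vector) chart set \<Rightarrow> bool" where
  "smooth_manifold T A \<longleftrightarrow>
     (\<exists>B::'e set. finite B \<and> span B = UNIV) \<and>
     Hausdorff_space T \<and> second_countable T \<and>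
     topspace T = (\<Union>(U, \<phi>)\<in>A. U) \<and>
     (\<forall>(U, \<phi>)\<in>A. openin T U \<and> open (\<phi> ` U) \<and>
        homeomorphic_map (subtopology T U) (top_of_set (\<phi> ` U)) \<phi>) \<and>
     (\<forall>(U, \<phi>)\<in>A. \<forall>(V, \<psi>)\<in>A. smooth_on (\<phi> ` (U \<inter> V)) (\<lambda>x. \<psi> (inv_into U \<phi> x)))"

definition smooth_map ::
  "'p topology \<Rightarrow> ('p, 'e::real_normed_vector) chart set \<Rightarrow>
   'q topology \<Rightarrow> ('q, 'f::real_normed_vector) chart set \<Rightarrow> ('p \<Rightarrow> 'q) \<Rightarrow> bool" where
  "smooth_map S A T B f \<longleftrightarrow>
     continuous_map S T f \<and>
     (\<forall>(U, \<phi>)\<in>A. \<forall>(V, \<psi>)\<in>B.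
        smooth_on (\<phi> ` {p \<in> U. f p \<in> V}) (\<lambda>x. \<psi> (f (inv_into U \<phi> x))))"

definition prod_atlas ::
  "('p, 'e) chart set \<Rightarrow> ('q, 'f) chart set \<Rightarrow> ('p \<times> 'q, 'e \<times> 'f) chart set" where
  "prod_atlas A B = (\<lambda>((U, \<phi>), (V, \<psi>)). (U \<times> V, map_prod \<phi> \<psi>)) ` (A \<times> B)"

definition lie_group ::
  "('g, 'z) monoid_scheme \<Rightarrow> 'g topology \<Rightarrow> ('g, 'e::real_normed_vector) chart set \<Rightarrow> bool" where
  "lie_group G T A \<longleftrightarrow>
     group G \<and> topspace T = carrier G \<and> smooth_manifold T A \<and>
     smooth_map (prod_topology T T) (prod_atlas A A) T A (\<lambda>(g, h). g \<otimes>\<^bsub>G\<^esub> h) \<and>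
     smooth_map T A T A (\<lambda>g. inv\<^bsub>G\<^esub> g)"

text \<open>
  As usual for linear actions of Lie groups, the action map is required to be jointly continuous;
  smoothness is then automatic.
\<close>

definition linear_action ::
  "('g, 'z) monoid_scheme \<Rightarrow> 'g topology \<Rightarrow> ('g \<Rightarrow> 'v::euclidean_space \<Rightarrow> 'v) \<Rightarrow> bool" where
  "linear_action G T act \<longleftrightarrow>
     group_action G UNIV act \<and> (\<forall>\<gamma>\<in>carrier G. linear (act \<gamma>)) \<and>
     continuous_map (prod_topology T euclidean) euclidean (\<lambda>(\<gamma>, v). act \<gamma> v)"


section \<open>Symplectic vector spaces and matrices\<close>

text \<open>
  The type \<open>'v\<close> plays the role of \<open>V\<close>. The class \<open>euclidean_space\<close> only serves to have a
  finite-dimensional real vector space with its topology; its inner product is never used.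
\<close>

definition symplectic_form :: "('v::euclidean_space \<Rightarrow> 'v \<Rightarrow> real) \<Rightarrow> bool" where
  "symplectic_form \<omega> \<longleftrightarrow>
     bilinear \<omega> \<and> (\<forall>u. \<omega> u u = 0) \<and> (\<forall>u. (\<forall>v. \<omega> u v = 0) \<longrightarrow> u = 0)"

definition is_basis :: "('m::finite \<Rightarrow> 'v::real_vector) \<Rightarrow> bool" where
  "is_basis b \<longleftrightarrow> inj b \<and> independent (range b) \<and> span (range b) = UNIV"

definition form_matrix ::
  "('m::finite \<Rightarrow> 'v::real_vector) \<Rightarrow> ('v \<Rightarrow> 'v \<Rightarrow> real) \<Rightarrow> real^'m^'m" where
  "form_matrix b \<omega> = (\<chi> i j. \<omega> (b i) (b j))"

definition matrix_in_basis :: "('m::finite \<Rightarrow> 'v::real_vector) \<Rightarrow> ('v \<Rightarrow> 'v) \<Rightarrow> real^'m^'m" where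
  "matrix_in_basis b L = (\<chi> i j. representation (range b) (L (b j)) (b i))"

definition Sp :: "('m::finite \<Rightarrow> 'v::real_vector) \<Rightarrow> ('v \<Rightarrow> 'v \<Rightarrow> real) \<Rightarrow> (real^'m^'m) set" where
  "Sp b \<omega> = {B. transpose B ** form_matrix b \<omega> ** B = form_matrix b \<omega>}"

definition anti_Sp :: "('m::finite \<Rightarrow> 'v::real_vector) \<Rightarrow> ('v \<Rightarrow> 'v \<Rightarrow> real) \<Rightarrow> (real^'m^'m) set" where
  "anti_Sp b \<omega> = {B. transpose B ** form_matrix b \<omega> ** B = - form_matrix b \<omega>}"

text \<open>The structure of matrix multiplication on a set \<open>S\<close> of matrices.\<close>

definition matrix_monoid :: "(real^'m^'m) set \<Rightarrow> (real^'m^'m::finite) monoid" where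
  "matrix_monoid S = \<lparr>carrier = S, mult = (**), one = mat 1\<rparr>"


section \<open>Semisymplectic actions\<close>

definition pullback_form ::
  "('v::real_normed_vector \<Rightarrow> 'v) \<Rightarrow> ('v \<Rightarrow> 'v \<Rightarrow> real) \<Rightarrow> 'v \<Rightarrow> 'v \<Rightarrow> 'v \<Rightarrow> real" where
  "pullback_form F \<omega> x u v = \<omega> (frechet_derivative F (at x) u) (frechet_derivative F (at x) v)"

text \<open>The group \<open>{1, -1}\<close> is \<^const>\<open>sign_img\<close>, whose elements are integers.\<close>

definition semisymplectic ::
  "('g, 'z) monoid_scheme \<Rightarrow> ('g \<Rightarrow> 'v::euclidean_space \<Rightarrow> 'v) \<Rightarrow> ('v \<Rightarrow> 'v \<Rightarrow> real) \<Rightarrow>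
   ('g \<Rightarrow> int) \<Rightarrow> bool" where
  "semisymplectic G act \<omega> \<sigma> \<longleftrightarrow>
     \<sigma> \<in> hom G sign_img \<and>
     (\<forall>\<gamma>\<in>carrier G. \<forall>x u v. pullback_form (act \<gamma>) \<omega> x u v = of_int (\<sigma> \<gamma>) * \<omega> u v)"

definition symplectic ::
  "('g, 'z) monoid_scheme \<Rightarrow> ('g \<Rightarrow> 'v::euclidean_space \<Rightarrow> 'v) \<Rightarrow> ('v \<Rightarrow> 'v \<Rightarrow> real) \<Rightarrow> bool" where
  "symplectic G act \<omega> \<longleftrightarrow> semisymplectic G act \<omega> (\<lambda>_. 1)"

end

theory Submission
  imports Defs
begin

text \<open>
  The \<open>(i, j)\<close> entry of $B^T[\omega]B$, for $B$ the matrix of a linear map \<open>L\<close>, is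
  $\omega(L b_i, L b_j)$, so $B^T[\omega]B = c[\omega]$ says that \<open>L\<close> scales \<open>\<omega>\<close> by \<open>c\<close>.
  A linear map is its own derivative, so this is also the pullback condition. As
  \<open>\<omega> \<noteq> 0\<close>, the scalar is determined by the map and depends on it multiplicatively; hence
  it is a homomorphism as soon as all its values are \<open>\<plusminus>1\<close>.
\<close>

section \<open>Coordinates and matrices of maps in a basis\<close>

lemma is_basis_expansion:
  assumes "is_basis b"
  shows "(\<Sum>i\<in>UNIV. representation (range b) x (b i) *\<^sub>R b i) = x"
proof -
  have "(\<Sum>v\<in>range b. representation (range b) x v *\<^sub>R v) = x"
    using assms by (intro real_vector.sum_representation_eq) (auto simp: is_basis_def)
  then show ?thesis
    using assms by (simp add: is_basis_def sum.reindex)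
qed

lemma representation_is_basis:
  assumes "is_basis b"
  shows "representation (range b) (b j) (b i) = (if i = j then 1 else 0)"
  using assms
  by (auto simp: is_basis_def real_vector.representation_basis dest: injD)

lemma linear_representation_is_basis:
  assumes "is_basis b"
  shows "linear (\<lambda>x. representation (range b) x v)"
  using assms
  by (intro linearI) (auto simp: is_basis_def real_vector.representation_add real_vector.representation_scale)

lemma matrix_in_basis_id:
  assumes "is_basis b"
  shows "matrix_in_basis b (\<lambda>x. x) = mat 1"
  using assms by (simp add: matrix_in_basis_def mat_def vec_eq_iff representation_is_basis)

text \<open>Expand \<open>K (b j)\<close> in the basis and apply the linear functional that sends
  \<open>x\<close> to the \<open>b i\<close> coordinate of \<open>L x\<close>: the coefficients form
  column \<open>j\<close> of the matrix of \<open>K\<close>, and the values of the functional on the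
  basis form row \<open>i\<close> of the matrix of \<open>L\<close>.\<close>

lemma matrix_in_basis_comp:
  assumes b: "is_basis b" and L: "linear L"
  shows "matrix_in_basis b (\<lambda>x. L (K x)) = matrix_in_basis b L ** matrix_in_basis b K"
proof -
  have "representation (range b) (L (K (b j))) (b i) =
      (\<Sum>k\<in>UNIV. representation (range b) (L (b k)) (b i) * representation (range b) (K (b j)) (b k))"
    for i j
  proof -
    have "linear (\<lambda>x. representation (range b) (L x) (b i))"
      using linear_compose[OF L linear_representation_is_basis[OF b]] by (simp add: o_def)
    then have "representation (range b) (L (\<Sum>k\<in>UNIV. representation (range b) (K (b j)) (b k) *\<^sub>R b k)) (b i) =
        (\<Sum>k\<in>UNIV. representation (range b) (K (b j)) (b k) *\<^sub>R representation (range b) (L (b k)) (b i))"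
      by (simp add: linear_sum[where f = "\<lambda>x. representation (range b) (L x) (b i)"]
          linear_cmul[where f = "\<lambda>x. representation (range b) (L x) (b i)"] del: real_scaleR_def)
    then show ?thesis
      by (simp add: is_basis_expansion[OF b] mult.commute)
  qed
  then show ?thesis
    by (simp add: matrix_in_basis_def matrix_matrix_mult_def vec_eq_iff)
qed

section \<open>Bilinear forms and their matrices\<close>

lemma bilinear_sum_scaleR:
  assumes "bilinear \<omega>"
  shows "\<omega> (\<Sum>i\<in>I. f i *\<^sub>R x i) (\<Sum>j\<in>J. g j *\<^sub>R y j) =
    (\<Sum>i\<in>I. \<Sum>j\<in>J. f i *\<^sub>R g j *\<^sub>R \<omega> (x i) (y j))"
proof -
  have l: "linear (\<lambda>u. \<omega> u v)" and r: "linear (\<omega> u)" for u v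
    using assms by (auto simp: bilinear_def)
  have "\<omega> (\<Sum>i\<in>I. f i *\<^sub>R x i) (\<Sum>j\<in>J. g j *\<^sub>R y j) =
      (\<Sum>i\<in>I. f i *\<^sub>R \<omega> (x i) (\<Sum>j\<in>J. g j *\<^sub>R y j))"
    by (simp only: linear_sum[OF l] linear_cmul[OF l])
  then show ?thesis
    by (simp only: linear_sum[OF r] linear_cmul[OF r] scaleR_sum_right)
qed

text \<open>Column \<open>j\<close> of \<open>matrix_in_basis b L\<close> holds the coordinates of
  \<open>L (b j)\<close>, so expanding both arguments of \<open>\<omega>\<close> in the basis
  produces the entries of the triple product.\<close>

lemma form_matrix_congruence:
  fixes \<omega> :: "'v::real_vector \<Rightarrow> 'v \<Rightarrow> real"
  assumes b: "is_basis b" and \<omega>: "bilinear \<omega>"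
  shows "transpose (matrix_in_basis b L) ** form_matrix b \<omega> ** matrix_in_basis b L =
    form_matrix b (\<lambda>u v. \<omega> (L u) (L v))"
proof -
  have "\<omega> (L (b i)) (L (b j)) =
      (\<Sum>l\<in>UNIV. (\<Sum>k\<in>UNIV. representation (range b) (L (b i)) (b k) * \<omega> (b k) (b l)) *
        representation (range b) (L (b j)) (b l))" for i j
  proof -
    have "\<omega> (L (b i)) (L (b j)) =
      (\<Sum>k\<in>UNIV. \<Sum>l\<in>UNIV. representation (range b) (L (b i)) (b k) *
        (representation (range b) (L (b j)) (b l) * \<omega> (b k) (b l)))"
      using bilinear_sum_scaleR[OF \<omega>, of "\<lambda>k. representation (range b) (L (b i)) (b k)" b UNIV
          "\<lambda>l. representation (range b) (L (b j)) (b l)" b UNIV]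
      by (simp add: is_basis_expansion[OF b])
    \<comment> \<open>The triple product associates to the left, so the index \<open>l\<close> of
      the last factor must become the outer one.\<close>
    also have "\<dots> = (\<Sum>l\<in>UNIV. \<Sum>k\<in>UNIV. representation (range b) (L (b i)) (b k) *
        (representation (range b) (L (b j)) (b l) * \<omega> (b k) (b l)))"
      by (rule sum.swap)
    finally show ?thesis
      by (simp add: sum_distrib_left sum_distrib_right mult_ac)
  qed
  then show ?thesis
    by (simp add: matrix_in_basis_def form_matrix_def matrix_matrix_mult_def transpose_def vec_eq_iff)
qed

text \<open>A bilinear form is determined by its values on pairs of basis vectors. This turns matrix
  identities into identities of forms.\<close>

lemma form_matrix_inject:
  fixes \<omega> \<eta> :: "'v::real_vector \<Rightarrow> 'v \<Rightarrow> real"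
  assumes b: "is_basis b" and "bilinear \<omega>" "bilinear \<eta>"
  shows "form_matrix b \<omega> = form_matrix b \<eta> \<longleftrightarrow> \<omega> = \<eta>"
proof
  assume "form_matrix b \<omega> = form_matrix b \<eta>"
  then have e: "\<omega> (b i) (b j) = \<eta> (b i) (b j)" for i j
    by (simp add: form_matrix_def vec_eq_iff)
  show "\<omega> = \<eta>"
  proof (intro ext)
    fix u v
    let ?f = "\<lambda>x i. representation (range b) x (b i)"
    have "\<omega> (\<Sum>i\<in>UNIV. ?f u i *\<^sub>R b i) (\<Sum>i\<in>UNIV. ?f v i *\<^sub>R b i) =
        \<eta> (\<Sum>i\<in>UNIV. ?f u i *\<^sub>R b i) (\<Sum>i\<in>UNIV. ?f v i *\<^sub>R b i)"
      by (simp only: bilinear_sum_scaleR[OF \<open>bilinear \<omega>\<close>] bilinear_sum_scaleR[OF \<open>bilinear \<eta>\<close>] e)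
    then show "\<omega> u v = \<eta> u v"
      by (simp add: is_basis_expansion[OF b])
  qed
qed simp

text \<open>Both matrices represent bilinear forms, so they agree exactly when the forms do. The
  scalar \<open>c\<close> is kept general so that \<open>c = 1\<close> covers \<open>Sp\<close> and
  \<open>c = -1\<close> covers \<open>anti_Sp\<close>.\<close>

lemma form_matrix_congruence_scaled_iff:
  fixes \<omega> :: "'v::real_vector \<Rightarrow> 'v \<Rightarrow> real"
  assumes b: "is_basis b" and \<omega>: "bilinear \<omega>" and L: "linear L"
  shows "transpose (matrix_in_basis b L) ** form_matrix b \<omega> ** matrix_in_basis b L =
      c *\<^sub>R form_matrix b \<omega> \<longleftrightarrow> (\<forall>u v. \<omega> (L u) (L v) = c * \<omega> u v)"
proof -
  have 1: "bilinear (\<lambda>u v. \<omega> (L u) (L v))"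
    using \<omega> L unfolding bilinear_def
    by (auto intro: linear_compose[unfolded o_def])
  have 2: "bilinear (\<lambda>u v. c * \<omega> u v)"
    using \<omega> unfolding bilinear_def
    by (simp add: linear_compose_scale_right flip: real_scaleR_def)
  have "c *\<^sub>R form_matrix b \<omega> = form_matrix b (\<lambda>u v. c * \<omega> u v)"
    by (simp add: form_matrix_def vec_eq_iff)
  then show ?thesis
    using form_matrix_inject[OF b 1 2]
    by (simp add: form_matrix_congruence[OF b \<omega>] fun_eq_iff)
qed

section \<open>Membership in \<open>Sp\<close> and \<open>anti_Sp\<close>, and their
  disjointness\<close>

lemma matrix_in_basis_mem_Sp_iff:
  assumes "is_basis b" "bilinear \<omega>" "linear L"
  shows "matrix_in_basis b L \<in> Sp b \<omega> \<longleftrightarrow> (\<forall>u v. \<omega> (L u) (L v) = \<omega> u v)"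
  using form_matrix_congruence_scaled_iff[OF assms, of 1] by (simp add: Sp_def)

lemma matrix_in_basis_mem_anti_Sp_iff:
  assumes "is_basis b" "bilinear \<omega>" "linear L"
  shows "matrix_in_basis b L \<in> anti_Sp b \<omega> \<longleftrightarrow> (\<forall>u v. \<omega> (L u) (L v) = - \<omega> u v)"
  using form_matrix_congruence_scaled_iff[OF assms, of "-1"] by (simp add: anti_Sp_def)

lemma pullback_form_linear:
  fixes L :: "'v::euclidean_space \<Rightarrow> 'v"
  assumes "linear L"
  shows "pullback_form L \<omega> x u v = \<omega> (L u) (L v)"
proof -
  have "(L has_derivative L) (at x)"
    using assms by (simp add: bounded_linear_imp_has_derivative linear_conv_bounded_linear)
  then have "frechet_derivative L (at x) = L"
    by (rule frechet_derivative_at[symmetric])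
  then show ?thesis
    by (simp add: pullback_form_def)
qed

text \<open>The class \<open>euclidean_space\<close> excludes dimension 0, so a nonzero vector
  exists, and non-degeneracy gives it a partner.\<close>

lemma symplectic_form_nonzero:
  fixes \<omega> :: "'v::euclidean_space \<Rightarrow> 'v \<Rightarrow> real"
  assumes "symplectic_form \<omega>"
  obtains u v where "\<omega> u v \<noteq> 0"
proof -
  obtain u :: 'v where "u \<noteq> 0"
    using nonempty_Basis nonzero_Basis by blast
  then show ?thesis
    using assms that unfolding symplectic_form_def by blast
qed

text \<open>A common element would force the matrix of \<open>\<omega>\<close> to equal its own
  negative, hence to vanish; then \<open>\<omega>\<close> itself would be zero.\<close>

lemma Sp_disjoint_anti_Sp:
  assumes b: "is_basis b" and \<omega>: "symplectic_form \<omega>"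
  shows "Sp b \<omega> \<inter> anti_Sp b \<omega> = {}"
proof -
  have False if "form_matrix b \<omega> = - form_matrix b \<omega>"
  proof -
    have bil: "bilinear \<omega>"
      using \<omega> by (simp add: symplectic_form_def)
    have "bilinear (\<lambda>u v :: 'b. 0 :: real)"
      by (simp add: bilinear_def linear_zero)
    moreover have "form_matrix b \<omega> = form_matrix b (\<lambda>u v. 0)"
      using that by (auto simp: form_matrix_def vec_eq_iff)
    ultimately have "\<omega> = (\<lambda>u v. 0)"
      using form_matrix_inject[OF b bil] by blast
    with symplectic_form_nonzero[OF \<omega>] show False
      by metis
  qed
  then show ?thesis
    by (auto simp: Sp_def anti_Sp_def)
qed

section \<open>From group actions to subgroups of matrices\<close>

lemma group_action_mult_apply:
  assumes "group_action G UNIV act" "g \<in> carrier G" "h \<in> carrier G"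
  shows "act (g \<otimes>\<^bsub>G\<^esub> h) x = act g (act h x)"
  using group_action.composition_rule[OF assms(1) UNIV_I assms(2,3)] by simp

lemma group_action_one_apply:
  assumes "group_action G UNIV act"
  shows "act \<one>\<^bsub>G\<^esub> x = x"
  using group_action.id_eq_one[OF assms] by (metis UNIV_I restrict_apply')

text \<open>Uniqueness of two-sided inverses, argued directly on matrices because \<open>S\<close>
  is an arbitrary set and \<open>matrix_monoid S\<close> may fail to be a monoid.\<close>

lemma m_inv_matrix_monoid:
  assumes "N \<in> S" "M ** N = mat 1" "N ** M = mat 1"
  shows "inv\<^bsub>matrix_monoid S\<^esub> M = N"
  unfolding m_inv_def
proof (rule the_equality)
  fix K
  assume "K \<in> carrier (matrix_monoid S) \<and>
    M \<otimes>\<^bsub>matrix_monoid S\<^esub> K = \<one>\<^bsub>matrix_monoid S\<^esub> \<and>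
    K \<otimes>\<^bsub>matrix_monoid S\<^esub> M = \<one>\<^bsub>matrix_monoid S\<^esub>"
  then have "K ** M = mat 1"
    by (simp add: matrix_monoid_def)
  then have "N = K ** (M ** N)"
    by (simp add: matrix_mul_assoc)
  then show "K = N"
    by (simp add: assms)
qed (use assms in \<open>auto simp: matrix_monoid_def\<close>)

text \<open>
  The inverse in \<^term>\<open>matrix_monoid S\<close> is a definite description over \<open>S\<close>; it is the inverse
  matrix only if that matrix lies in \<open>S\<close>.
\<close>

lemma subgroup_matrix_monoid_iff:
  assumes G: "group G" and act: "group_action G UNIV act"
    and lin: "\<And>g. g \<in> carrier G \<Longrightarrow> linear (act g)" and b: "is_basis b"
  shows "subgroup ((\<lambda>g. matrix_in_basis b (act g)) ` carrier G) (matrix_monoid S) \<longleftrightarrow>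
    (\<forall>g\<in>carrier G. matrix_in_basis b (act g) \<in> S)"
proof
  let ?\<rho> = "\<lambda>g. matrix_in_basis b (act g)"
  interpret group G by (rule G)
  assume S: "\<forall>g\<in>carrier G. ?\<rho> g \<in> S"
  \<comment> \<open>The closure properties of the image come from \<open>?\<rho>\<close> respecting
    products and the unit; \<open>S\<close> enters only through membership.\<close>
  have mult: "?\<rho> (g \<otimes>\<^bsub>G\<^esub> h) = ?\<rho> g ** ?\<rho> h" if "g \<in> carrier G" "h \<in> carrier G" for g h
  proof -
    have "act (g \<otimes>\<^bsub>G\<^esub> h) = (\<lambda>x. act g (act h x))"
      using that by (simp add: group_action_mult_apply[OF act] fun_eq_iff)
    then show ?thesis
      using that by (simp add: matrix_in_basis_comp[OF b] lin)
  qed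
  have "act \<one>\<^bsub>G\<^esub> = (\<lambda>x. x)"
    by (simp add: group_action_one_apply[OF act] fun_eq_iff)
  then have one: "?\<rho> \<one>\<^bsub>G\<^esub> = mat 1"
    by (simp add: matrix_in_basis_id[OF b])
  \<comment> \<open>The candidate inverse lies in \<open>S\<close> by the assumption applied to the
    inverse group element.\<close>
  have inv: "inv\<^bsub>matrix_monoid S\<^esub> (?\<rho> g) = ?\<rho> (inv\<^bsub>G\<^esub> g)" if "g \<in> carrier G" for g
    using that S by (intro m_inv_matrix_monoid) (simp_all flip: mult one)
  show "subgroup (?\<rho> ` carrier G) (matrix_monoid S)"
  proof (rule subgroup.intro)
    show "?\<rho> ` carrier G \<subseteq> carrier (matrix_monoid S)"
      using S by (auto simp: matrix_monoid_def)
    show "\<one>\<^bsub>matrix_monoid S\<^esub> \<in> ?\<rho> ` carrier G"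
      by (simp add: matrix_monoid_def flip: one)
  next
    fix x y
    assume "x \<in> ?\<rho> ` carrier G" "y \<in> ?\<rho> ` carrier G"
    then show "x \<otimes>\<^bsub>matrix_monoid S\<^esub> y \<in> ?\<rho> ` carrier G"
      by (auto simp: matrix_monoid_def simp flip: mult)
  next
    fix x
    assume "x \<in> ?\<rho> ` carrier G"
    then show "inv\<^bsub>matrix_monoid S\<^esub> x \<in> ?\<rho> ` carrier G"
      by (auto simp: inv)
  qed
qed (auto simp: subgroup_def matrix_monoid_def)

lemma scaling_factor_hom:
  assumes act: "group_action G UNIV act" and G: "group G"
    and nz: "\<omega> u v \<noteq> (0::real)"
    and \<sigma>: "\<And>g. g \<in> carrier G \<Longrightarrow> \<sigma> g \<in> {-1, 1}"
    and scale: "\<And>g x y. g \<in> carrier G \<Longrightarrow> \<omega> (act g x) (act g y) = of_int (\<sigma> g) * \<omega> x y"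
  shows "\<sigma> \<in> hom G sign_img"
proof (rule homI)
  interpret group G by (rule G)
  fix g h
  assume gh: "g \<in> carrier G" "h \<in> carrier G"
  \<comment> \<open>Both sides compute \<open>\<omega>\<close> on the images of \<open>u\<close> and
    \<open>v\<close> under the product: once directly, once one factor at a time.\<close>
  have "of_int (\<sigma> (g \<otimes>\<^bsub>G\<^esub> h)) * \<omega> u v = of_int (\<sigma> g * \<sigma> h) * \<omega> u v"
    using gh scale[of "g \<otimes>\<^bsub>G\<^esub> h" u v] by (auto simp: group_action_mult_apply[OF act] scale)
  \<comment> \<open>The product stays inside \<open>of_int\<close>, so that cancelling
    \<open>\<omega> u v\<close> leaves an equation to which injectivity of \<open>of_int\<close>
    applies.\<close>
  then have "\<sigma> (g \<otimes>\<^bsub>G\<^esub> h) = \<sigma> g * \<sigma> h"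
    using nz by (simp del: of_int_mult)
  then show "\<sigma> (g \<otimes>\<^bsub>G\<^esub> h) = \<sigma> g \<otimes>\<^bsub>sign_img\<^esub> \<sigma> h"
    by (simp add: sign_img_def)
qed (use \<sigma> in \<open>auto simp: sign_img_def\<close>)

theorem theorem3p2:
  fixes \<Gamma> :: "('g, 'z) monoid_scheme"
    and T :: "'g topology"
    and A :: "('g, 'e::real_normed_vector) chart set"
    and act :: "'g \<Rightarrow> 'v::euclidean_space \<Rightarrow> 'v"
    and \<omega> :: "'v \<Rightarrow> 'v \<Rightarrow> real"
    and b :: "'m::finite \<Rightarrow> 'v"
    and \<rho> :: "'g \<Rightarrow> real^'m^'m"
    and n :: nat
  assumes "lie_group \<Gamma> T A"
    and "symplectic_form \<omega>"
    and "DIM('v) = 2 * n"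
    and "is_basis b"
    and "linear_action \<Gamma> T act"
    and "\<And>\<gamma>. \<rho> \<gamma> = matrix_in_basis b (act \<gamma>)"
  shows "Sp b \<omega> \<inter> anti_Sp b \<omega> = {} \<and>
    (subgroup (\<rho> ` carrier \<Gamma>) (matrix_monoid (Sp b \<omega> \<union> anti_Sp b \<omega>)) \<longleftrightarrow>
       (\<exists>\<sigma>. semisymplectic \<Gamma> act \<omega> \<sigma>)) \<and>
    (subgroup (\<rho> ` carrier \<Gamma>) (matrix_monoid (Sp b \<omega>)) \<longleftrightarrow> symplectic \<Gamma> act \<omega>)"
proof (intro conjI)
  have G: "group \<Gamma>"
    using assms(1) by (simp add: lie_group_def)
  have act: "group_action \<Gamma> UNIV act" and lin: "\<And>g. g \<in> carrier \<Gamma> \<Longrightarrow> linear (act g)"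
    using assms(5) by (auto simp: linear_action_def)
  have bil: "bilinear \<omega>"
    using assms(2) by (simp add: symplectic_form_def)
  obtain u v where nz: "\<omega> u v \<noteq> 0"
    using symplectic_form_nonzero[OF assms(2)] .
  have \<rho>: "\<rho> = (\<lambda>g. matrix_in_basis b (act g))"
    using assms(6) by auto
  \<comment> \<open>Stated for every \<open>S\<close>, since both equivalences reduce to pointwise
    membership through it.\<close>
  have sub: "subgroup (\<rho> ` carrier \<Gamma>) (matrix_monoid S) \<longleftrightarrow> (\<forall>g\<in>carrier \<Gamma>. \<rho> g \<in> S)" for S
    unfolding \<rho> by (rule subgroup_matrix_monoid_iff[OF G act lin assms(4)])
  have Sp: "\<rho> g \<in> Sp b \<omega> \<longleftrightarrow> (\<forall>x y. \<omega> (act g x) (act g y) = \<omega> x y)"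
    and anti: "\<rho> g \<in> anti_Sp b \<omega> \<longleftrightarrow> (\<forall>x y. \<omega> (act g x) (act g y) = - \<omega> x y)"
    if "g \<in> carrier \<Gamma>" for g
    using that by (simp_all add: \<rho> matrix_in_basis_mem_Sp_iff[OF assms(4) bil]
        matrix_in_basis_mem_anti_Sp_iff[OF assms(4) bil] lin)
  have semi: "semisymplectic \<Gamma> act \<omega> \<sigma> \<longleftrightarrow> \<sigma> \<in> hom \<Gamma> sign_img \<and>
      (\<forall>g\<in>carrier \<Gamma>. \<forall>x y. \<omega> (act g x) (act g y) = of_int (\<sigma> g) * \<omega> x y)" for \<sigma>
    by (simp add: semisymplectic_def pullback_form_linear lin)
  show "Sp b \<omega> \<inter> anti_Sp b \<omega> = {}"
    by (rule Sp_disjoint_anti_Sp[OF assms(4,2)])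
  show "subgroup (\<rho> ` carrier \<Gamma>) (matrix_monoid (Sp b \<omega> \<union> anti_Sp b \<omega>)) \<longleftrightarrow>
      (\<exists>\<sigma>. semisymplectic \<Gamma> act \<omega> \<sigma>)"
  proof
    assume "subgroup (\<rho> ` carrier \<Gamma>) (matrix_monoid (Sp b \<omega> \<union> anti_Sp b \<omega>))"
    then have mem: "\<rho> g \<in> Sp b \<omega> \<or> \<rho> g \<in> anti_Sp b \<omega>" if "g \<in> carrier \<Gamma>" for g
      using that by (simp add: sub)
    \<comment> \<open>By \<open>mem\<close>, on the carrier the default \<open>- 1\<close> occurs
      only when \<open>\<rho> g\<close> lies in \<open>anti_Sp b \<omega>\<close>, where it is the
      correct factor.\<close>
    define \<sigma> :: "'g \<Rightarrow> int" where "\<sigma> g = (if \<rho> g \<in> Sp b \<omega> then 1 else - 1)" for g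
    have scale: "\<omega> (act g x) (act g y) = of_int (\<sigma> g) * \<omega> x y" if "g \<in> carrier \<Gamma>" for g x y
      using mem[OF that] Sp[OF that] anti[OF that] by (auto simp: \<sigma>_def)
    have "\<sigma> \<in> hom \<Gamma> sign_img"
      by (rule scaling_factor_hom[where \<omega> = \<omega> and u = u and v = v, OF act G nz _ scale]) (auto simp: \<sigma>_def)
    then show "\<exists>\<sigma>. semisymplectic \<Gamma> act \<omega> \<sigma>"
      using scale semi by blast
  next
    assume "\<exists>\<sigma>. semisymplectic \<Gamma> act \<omega> \<sigma>"
    then obtain \<sigma> where \<sigma>: "\<sigma> \<in> hom \<Gamma> sign_img"
      and scale: "\<And>g x y. g \<in> carrier \<Gamma> \<Longrightarrow> \<omega> (act g x) (act g y) = of_int (\<sigma> g) * \<omega> x y"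
      using semi by blast
    have "\<rho> g \<in> Sp b \<omega> \<union> anti_Sp b \<omega>" if "g \<in> carrier \<Gamma>" for g
    proof -
      \<comment> \<open>The carrier of \<open>sign_img\<close> leaves two values, one for each of
        the two sets of matrices.\<close>
      have "\<sigma> g = -1 \<or> \<sigma> g = 1"
        using hom_in_carrier[OF \<sigma> that] by (auto simp: sign_img_def)
      then show ?thesis
        using that by (auto simp: Sp anti scale)
    qed
    then show "subgroup (\<rho> ` carrier \<Gamma>) (matrix_monoid (Sp b \<omega> \<union> anti_Sp b \<omega>))"
      by (simp add: sub)
  qed
  \<comment> \<open>With the trivial homomorphism, \<open>symplectic\<close> reduces to invariance
    of \<open>\<omega>\<close>, which is membership in \<open>Sp b \<omega>\<close>.\<close>
  have "(\<lambda>_. 1) \<in> hom \<Gamma> sign_img"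
    by (auto simp: hom_def sign_img_def)
  then show "subgroup (\<rho> ` carrier \<Gamma>) (matrix_monoid (Sp b \<omega>)) \<longleftrightarrow> symplectic \<Gamma> act \<omega>"
    by (simp add: sub Sp symplectic_def semi)
qed

end
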